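(* Let $D$ and $F$ be digraphs. The strong product $D\boxtimes F$ is an ECD digraph if and only if $D$ and $F$ are ECD digraphs.
   Context: Digraphs are finite. The strong product $D\boxtimes F$ has vertex set $V(D)\times V(F)$ and an arc from $(d,f)$ to $(d',f')$ iff ($(d,d')\in A(D)$ and $f=f'$) or ($d=d'$ and $(f,f')\in A(F)$) or ($(d,d')\in A(D)$ and $(f,f')\in A(F)$). With $N^+_D[v]=\{v\}\cup\{u:(v,u)\in A(D)\}$, a set $S$ is an ECD set of $D$ if $\{N^+_D[v]:v\in S\}$ is a partition of $V(D)$, and $D$ is an ECD digraph if it has an ECD set. *)

theory Defs
  imports "Graph_Theory.Pair_Digraph" "HOL-Library.Disjoint_Sets"
begin

definition strong_product ::
    "'a pair_pre_digraph \<Rightarrow> 'b pair_pre_digraph \<Rightarrow> ('a \<times> 'b) pair_pre_digraph"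
    (infixl \<open>\<boxtimes>\<close> 70) where
  "D \<boxtimes> F = \<lparr> pverts = pverts D \<times> pverts F,
     parcs = {((d, f), (d', f')).
       d \<in> pverts D \<and> f \<in> pverts F \<and> d' \<in> pverts D \<and> f' \<in> pverts F \<and>
       ((d, d') \<in> parcs D \<and> f = f' \<or>
        d = d' \<and> (f, f') \<in> parcs F \<or>
        (d, d') \<in> parcs D \<and> (f, f') \<in> parcs F)} \<rparr>"

definition closed_out_nbhd :: "'a pair_pre_digraph \<Rightarrow> 'a \<Rightarrow> 'a set" where
  "closed_out_nbhd D v = {v} \<union> {u. (v, u) \<in> parcs D}"

(* The condition is on the set of neighbourhoods, so distinct vertices of S may share the same
   closed out-neighbourhood. Lemma ECD_digraph_iff_family below shows that requiring S to be free
   of such repetitions gives the same ECD digraphs. *)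
definition ECD_set :: "'a pair_pre_digraph \<Rightarrow> 'a set \<Rightarrow> bool" where
  "ECD_set D S \<longleftrightarrow> S \<subseteq> pverts D \<and> partition_on (pverts D) {closed_out_nbhd D v | v. v \<in> S}"

definition ECD_digraph :: "'a pair_pre_digraph \<Rightarrow> bool" where
  "ECD_digraph D \<longleftrightarrow> (\<exists>S. ECD_set D S)"

lemma pair_fin_digraph_strong_product:
  assumes "pair_fin_digraph D" "pair_fin_digraph F"
  shows "pair_fin_digraph (D \<boxtimes> F)"
proof -
  interpret D: pair_fin_digraph D by fact
  interpret F: pair_fin_digraph F by fact
  let ?V = "pverts D \<times> pverts F"
  have V: "finite ?V"
    using D.pair_finite_verts F.pair_finite_verts by simp
  have sub: "parcs (D \<boxtimes> F) \<subseteq> ?V \<times> ?V"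
    by (auto simp: strong_product_def)
  show ?thesis
  proof
    show "finite (parcs (D \<boxtimes> F))"
      using sub V by (meson finite_SigmaI finite_subset)
    show "finite (pverts (D \<boxtimes> F))"
      using V by (simp add: strong_product_def)
  qed (use sub in \<open>auto simp: strong_product_def\<close>)
qed

lemma ECD_digraph_iff_family:
  "ECD_digraph D \<longleftrightarrow>
    (\<exists>S \<subseteq> pverts D. disjoint_family_on (closed_out_nbhd D) S \<and>
      (\<Union>v\<in>S. closed_out_nbhd D v) = pverts D)"
  (is "_ \<longleftrightarrow> (\<exists>S \<subseteq> _. ?P S)")
proof
  assume "ECD_digraph D"
  then obtain S where S: "S \<subseteq> pverts D" "partition_on (pverts D) (closed_out_nbhd D ` S)"
    unfolding ECD_digraph_def ECD_set_def Setcompr_eq_image by blast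
  obtain T where T: "T \<subseteq> S" "inj_on (closed_out_nbhd D) T"
    "closed_out_nbhd D ` S = closed_out_nbhd D ` T"
    using subset_image_inj[of "closed_out_nbhd D ` S" "closed_out_nbhd D" S] by (meson order_refl)
  have "disjoint (closed_out_nbhd D ` T)"
    using S(2) T(3) by (simp add: partition_on_def)
  then have "disjoint_family_on (closed_out_nbhd D) T"
    using T(2) by (rule disjoint_image_disjoint_family_on)
  moreover have "(\<Union>v\<in>T. closed_out_nbhd D v) = pverts D"
    using S(2) T(3) by (simp add: partition_on_def)
  ultimately show "\<exists>S \<subseteq> pverts D. ?P S"
    using S(1) T(1) by blast
next
  assume "\<exists>S \<subseteq> pverts D. ?P S"
  then obtain S where S: "S \<subseteq> pverts D" "?P S" by blast
  have "disjoint (closed_out_nbhd D ` S)"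
    using S(2) by (simp add: disjoint_family_on_disjoint_image)
  moreover have "{} \<notin> closed_out_nbhd D ` S"
    by (auto simp: closed_out_nbhd_def)
  ultimately have "ECD_set D S"
    using S by (simp add: ECD_set_def partition_on_def Setcompr_eq_image)
  then show "ECD_digraph D"
    by (auto simp: ECD_digraph_def)
qed

end

theory Submission
  imports Defs
begin

text \<open>
  A closed out-neighbourhood of the product is the rectangle \<open>N[d] \<times> N[f]\<close>. If such rectangles tile
  \<open>V(D) \<times> V(F)\<close>, then restricting the tiling to a row \<open>V(D) \<times> {y}\<close> tiles \<open>V(D)\<close> by the sides
  \<open>N[d]\<close> of the rectangles that meet this row, and symmetrically for columns. Conversely, the
  products of the members of two tilings tile the product.
\<close>

text \<open>The three kinds of product arcs, together with the vertex \<open>(d, f)\<close> itself,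
  are the four ways to choose "equal or joined by an arc" in each coordinate. Well-formedness
  ensures that arc heads are vertices, as arcs of the product require.\<close>

lemma closed_out_nbhd_strong_product:
  assumes "pair_wf_digraph D" "pair_wf_digraph F" "d \<in> pverts D" "f \<in> pverts F"
  shows "closed_out_nbhd (D \<boxtimes> F) (d, f) = closed_out_nbhd D d \<times> closed_out_nbhd F f"
  using assms(3,4) pair_wf_digraph.in_arcsD2[OF assms(1)] pair_wf_digraph.in_arcsD2[OF assms(2)]
  by (auto simp: closed_out_nbhd_def strong_product_def)

text \<open>This indexed form allows the centres to be projections of product vertices: below,
  \<open>I\<close> consists of product vertices and \<open>v\<close> is \<open>fst\<close> or
  \<open>snd\<close>.\<close>

lemma ECD_digraphI:
  assumes "v ` I \<subseteq> pverts D" "disjoint_family_on (\<lambda>i. closed_out_nbhd D (v i)) I"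
    "(\<Union>i\<in>I. closed_out_nbhd D (v i)) = pverts D"
  shows "ECD_digraph D"
  unfolding ECD_digraph_iff_family
proof (intro exI conjI)
  show "disjoint_family_on (closed_out_nbhd D) (v ` I)"
    using assms(2) unfolding disjoint_family_on_def by (metis imageE)
qed (use assms(1,3) in auto)

text \<open>Two rectangles that meet row \<open>y\<close> share \<open>y\<close> in their second
  sides, so they can be disjoint only if their first sides are.\<close>

lemma rectangle_tiling_row:
  assumes "disjoint_family_on (\<lambda>i. A i \<times> B i) I" "(\<Union>i\<in>I. A i \<times> B i) = X \<times> Y" "y \<in> Y"
  shows "disjoint_family_on A {i \<in> I. y \<in> B i}" "(\<Union>i\<in>{i \<in> I. y \<in> B i}. A i) = X"
proof -
  show "disjoint_family_on A {i \<in> I. y \<in> B i}"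
    using assms(1) unfolding disjoint_family_on_def by blast
  have "x \<in> (\<Union>i\<in>{i \<in> I. y \<in> B i}. A i) \<longleftrightarrow> (x, y) \<in> (\<Union>i\<in>I. A i \<times> B i)" for x
    by blast
  then show "(\<Union>i\<in>{i \<in> I. y \<in> B i}. A i) = X"
    using assms(3) by (intro set_eqI) (simp only: assms(2) mem_Times_iff fst_conv snd_conv simp_thms)
qed

lemma rectangle_tiling_column:
  assumes "disjoint_family_on (\<lambda>i. A i \<times> B i) I" "(\<Union>i\<in>I. A i \<times> B i) = X \<times> Y" "x \<in> X"
  shows "disjoint_family_on B {i \<in> I. x \<in> A i}" "(\<Union>i\<in>{i \<in> I. x \<in> A i}. B i) = Y"
proof -
  have "disjoint_family_on (\<lambda>i. B i \<times> A i) I"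
    using assms(1) unfolding disjoint_family_on_def by blast
  \<comment> \<open>Exchanging the coordinates turns the column into a row of the swapped
    tiling.\<close>
  moreover have "(\<Union>i\<in>I. B i \<times> A i) = prod.swap ` (\<Union>i\<in>I. A i \<times> B i)"
    by (simp add: image_UN product_swap)
  then have "(\<Union>i\<in>I. B i \<times> A i) = Y \<times> X"
    by (simp add: assms(2) product_swap)
  ultimately
  show "disjoint_family_on B {i \<in> I. x \<in> A i}" "(\<Union>i\<in>{i \<in> I. x \<in> A i}. B i) = Y"
    by (rule rectangle_tiling_row[OF _ _ assms(3)])+
qed

theorem theorem10:
  fixes D :: "'a pair_pre_digraph" and F :: "'b pair_pre_digraph"
  assumes "pair_fin_digraph D" and "pair_fin_digraph F"
    and "pverts D \<noteq> {}" and "pverts F \<noteq> {}"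
  shows "ECD_digraph (D \<boxtimes> F) \<longleftrightarrow> ECD_digraph D \<and> ECD_digraph F"
proof
  let ?N = "closed_out_nbhd D" and ?M = "closed_out_nbhd F"
  have wf: "pair_wf_digraph D" "pair_wf_digraph F"
    using assms(1,2) by (auto simp: pair_fin_digraph_def)
  have nbhd: "closed_out_nbhd (D \<boxtimes> F) p = ?N (fst p) \<times> ?M (snd p)"
    if "p \<in> pverts D \<times> pverts F" for p
    using closed_out_nbhd_strong_product[OF wf] that by (cases p) simp
  have verts: "pverts (D \<boxtimes> F) = pverts D \<times> pverts F"
    by (simp add: strong_product_def)
  {
    assume "ECD_digraph (D \<boxtimes> F)"
    then obtain S where S: "S \<subseteq> pverts D \<times> pverts F"
      "disjoint_family_on (closed_out_nbhd (D \<boxtimes> F)) S"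
      "(\<Union>p\<in>S. closed_out_nbhd (D \<boxtimes> F) p) = pverts D \<times> pverts F"
      unfolding ECD_digraph_iff_family verts by blast
    have dis: "disjoint_family_on (\<lambda>p. ?N (fst p) \<times> ?M (snd p)) S"
      unfolding disjoint_family_on_def
    proof (intro ballI impI)
      fix p q assume pq: "p \<in> S" "q \<in> S" "p \<noteq> q"
      then have "p \<in> pverts D \<times> pverts F" "q \<in> pverts D \<times> pverts F"
        using S(1) by blast+
      then show "(?N (fst p) \<times> ?M (snd p)) \<inter> (?N (fst q) \<times> ?M (snd q)) = {}"
        using disjoint_family_onD[OF S(2) pq] by (simp only: nbhd)
    qed
    have cover: "(\<Union>p\<in>S. ?N (fst p) \<times> ?M (snd p)) = pverts D \<times> pverts F"
      unfolding S(3)[symmetric] using S(1) by (intro SUP_cong refl nbhd[symmetric]) blast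
    \<comment> \<open>Nonempty factors supply a row \<open>y\<close>, whose rectangles yield centres
      for \<open>D\<close>, and a column \<open>x\<close>, whose rectangles yield centres for
      \<open>F\<close>.\<close>
    obtain x y where xy: "x \<in> pverts D" "y \<in> pverts F"
      using assms(3,4) by blast
    show "ECD_digraph D \<and> ECD_digraph F"
    proof
      show "ECD_digraph D"
        by (rule ECD_digraphI[OF _ rectangle_tiling_row[OF dis cover xy(2)]]) (use S(1) in auto)
      show "ECD_digraph F"
        by (rule ECD_digraphI[OF _ rectangle_tiling_column[OF dis cover xy(1)]]) (use S(1) in auto)
    qed
  }
  {
    assume "ECD_digraph D \<and> ECD_digraph F"
    then have D: "ECD_digraph D" and F: "ECD_digraph F"
      by simp_all
    obtain S where S: "S \<subseteq> pverts D" "disjoint_family_on ?N S" "(\<Union>d\<in>S. ?N d) = pverts D"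
      using D unfolding ECD_digraph_iff_family by blast
    obtain T where T: "T \<subseteq> pverts F" "disjoint_family_on ?M T" "(\<Union>f\<in>T. ?M f) = pverts F"
      using F unfolding ECD_digraph_iff_family by blast
    have sub: "S \<times> T \<subseteq> pverts D \<times> pverts F"
      using S(1) T(1) by blast
    have "disjoint_family_on (closed_out_nbhd (D \<boxtimes> F)) (S \<times> T)"
      unfolding disjoint_family_on_def
    proof (intro ballI impI)
      fix p q assume pq: "p \<in> S \<times> T" "q \<in> S \<times> T" "p \<noteq> q"
      \<comment> \<open>Distinct pairs differ in some coordinate, and disjointness in that factor
        alone separates the rectangles.\<close>
      then have "?N (fst p) \<inter> ?N (fst q) = {} \<or> ?M (snd p) \<inter> ?M (snd q) = {}"
        using disjoint_family_onD[OF S(2)] disjoint_family_onD[OF T(2)]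
        by (metis mem_Times_iff prod_eqI)
      moreover have "p \<in> pverts D \<times> pverts F" "q \<in> pverts D \<times> pverts F"
        using pq sub by blast+
      ultimately show "closed_out_nbhd (D \<boxtimes> F) p \<inter> closed_out_nbhd (D \<boxtimes> F) q = {}"
        by (simp only: nbhd Times_Int_Times) blast
    qed
    moreover have "(\<Union>p\<in>S \<times> T. closed_out_nbhd (D \<boxtimes> F) p) = (\<Union>p\<in>S \<times> T. ?N (fst p) \<times> ?M (snd p))"
      using sub by (intro SUP_cong refl nbhd) blast
    \<comment> \<open>Since \<open>p\<close> ranges over all of \<open>S \<times> T\<close>, the two
      coordinates can be covered independently.\<close>
    moreover have "\<dots> = (\<Union>d\<in>S. ?N d) \<times> (\<Union>f\<in>T. ?M f)"
      by fastforce
    ultimately show "ECD_digraph (D \<boxtimes> F)"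
      unfolding ECD_digraph_iff_family verts using sub S(3) T(3)
      by (intro exI[of _ "S \<times> T"]) (simp only: simp_thms)
  }
qed

end
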